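(* Let $G$ be a finite directed graph in which every vertex has in-degree and out-degree $d$, let $F_1,\dots,F_d$ be a 1-factoring of $G$, let $W=\{\omega_0=\emptyset,\omega_1,\omega_2,\dots\}$ be a finite list of words in the symbols $F_1,\dots,F_d$, and suppose a schedule for this factorization (with word list $W$) is given. For every vertex $v$ and every non-empty $\omega_i\in W$, label each edge of the directed path $v\omega_i$ by the time that the schedule assigns to the corresponding occurrence of a factor in $\omega_i$. Then in the collection of all directed label-increasing paths $v\omega_i$ ($v$ any vertex, $\omega_i$ any non-empty word of $W$), no edge of $G$ is assigned the same time twice. (That is, if $(v,i,p)\neq(v',i',p')$, where $p,p'$ are positions in the words $\omega_i,\omega_{i'}$, then the $p$-th edge of $v\omega_i$ with its time and the $p'$-th edge of $v'\omega_{i'}$ with its time do not agree both as edges and as times.) Moreover, if the factorization is a spanning factorization with word list $W$, then a schedule yields in this way a time-labeled directed path from every vertex to every other vertex so that no edge is labeled with the same time twice.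
   Context: A 1-factor of a directed graph $G$ is a (spanning) subgraph in which every vertex has in-degree and out-degree equal to 1. A 1-factoring of a directed graph with all in-degrees and out-degrees equal to $d$ is a decomposition of its edge set into $d$ edge-disjoint 1-factors $F_1,\dots,F_d$. A word is a finite string of symbols from $\{F_1,\dots,F_d\}$. If $v$ is a vertex and $\omega$ is a word, $v\omega$ denotes the directed path (and also its endpoint) starting at $v$ and following successively, for each consecutive symbol of $\omega$, the unique edge of that factor leaving the current vertex. If $G$ has $n$ vertices, a 1-factoring together with a set of $n$ words $W=\{\omega_0,\omega_1,\dots,\omega_{n-1}\}$ with $\omega_0=\emptyset$ is a spanning factorization of $G$ (with word list $W$) if for every vertex $v$ the vertices $v\omega_0,\dots,v\omega_{n-1}$ are distinct. A schedule for a factorization with word list $W$ is an assignment of a time (a positive integer) to each occurrence of each factor in the words of $W$ such that no time is assigned more than once to the same factor (i.e. two different occurrences of the same factor, in the same or in different words, get different times), and such that along each single word the assigned times are strictly increasing. *)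

theory Defs
  imports "HOL-Library.Disjoint_Sets" "Graph_Theory.Digraph_Component"
begin

text \<open>Loops and parallel arcs are allowed.\<close>

definition regular_digraph :: "('a,'b) pre_digraph \<Rightarrow> nat \<Rightarrow> bool" where
  "regular_digraph G d \<longleftrightarrow> fin_digraph G \<and>
     (\<forall>v\<in>verts G. in_degree G v = d \<and> out_degree G v = d)"

definition one_factor :: "('a,'b) pre_digraph \<Rightarrow> ('a,'b) pre_digraph \<Rightarrow> bool" where
  "one_factor H G \<longleftrightarrow> spanning H G \<and>
     (\<forall>v\<in>verts H. in_degree H v = 1 \<and> out_degree H v = 1)"

definition one_factoring ::
    "('a,'b) pre_digraph \<Rightarrow> nat \<Rightarrow> (nat \<Rightarrow> ('a,'b) pre_digraph) \<Rightarrow> bool" where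
  "one_factoring G d F \<longleftrightarrow>
     (\<forall>k\<in>{1..d}. one_factor (F k) G) \<and>
     disjoint_family_on (\<lambda>k. arcs (F k)) {1..d} \<and>
     (\<Union>k\<in>{1..d}. arcs (F k)) = arcs G"

text \<open>The symbol \<open>F k\<close> of a word is encoded by its index \<open>k\<close>. Words are referred to by
  their position in the list, so the same word may be listed several times.\<close>

definition word_list :: "nat \<Rightarrow> nat list list \<Rightarrow> bool" where
  "word_list d W \<longleftrightarrow> W \<noteq> [] \<and> W ! 0 = [] \<and> set W \<subseteq> lists {1..d}"

text \<open>The unique arc of a 1-factor leaving \<open>v\<close>.\<close>

definition factor_arc :: "('a,'b) pre_digraph \<Rightarrow> 'a \<Rightarrow> 'b" where
  "factor_arc H v = (THE e. e \<in> out_arcs H v)"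

text \<open>The arcs of \<open>v\<omega>\<close> in order, and its endpoint.\<close>

primrec word_path :: "(nat \<Rightarrow> ('a,'b) pre_digraph) \<Rightarrow> 'a \<Rightarrow> nat list \<Rightarrow> 'b awalk" where
  "word_path F v [] = []"
| "word_path F v (k # w) =
     factor_arc (F k) v # word_path F (head (F k) (factor_arc (F k) v)) w"

definition word_end ::
    "('a,'b) pre_digraph \<Rightarrow> (nat \<Rightarrow> ('a,'b) pre_digraph) \<Rightarrow> 'a \<Rightarrow> nat list \<Rightarrow> 'a" where
  "word_end G F v w = pre_digraph.awlast G v (word_path F v w)"

definition spanning_factorization ::
    "('a,'b) pre_digraph \<Rightarrow> nat \<Rightarrow> (nat \<Rightarrow> ('a,'b) pre_digraph) \<Rightarrow> nat list list \<Rightarrow> bool" where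
  "spanning_factorization G d F W \<longleftrightarrow>
     one_factoring G d F \<and> word_list d W \<and> length W = card (verts G) \<and>
     (\<forall>v\<in>verts G. inj_on (\<lambda>i. word_end G F v (W ! i)) {..<length W})"

text \<open>An occurrence \<open>(i, p)\<close> is position \<open>p\<close> in the word \<open>W ! i\<close>.\<close>

definition occurrences :: "nat list list \<Rightarrow> (nat \<times> nat) set" where
  "occurrences W = {(i, p). i < length W \<and> p < length (W ! i)}"

definition schedule :: "nat list list \<Rightarrow> (nat \<Rightarrow> nat \<Rightarrow> nat) \<Rightarrow> bool" where
  "schedule W t \<longleftrightarrow>
     (\<forall>(i, p)\<in>occurrences W. 0 < t i p) \<and>
     (\<forall>(i, p)\<in>occurrences W. \<forall>(i', p')\<in>occurrences W.
        (i, p) \<noteq> (i', p') \<and> W ! i ! p = W ! i' ! p' \<longrightarrow> t i p \<noteq> t i' p') \<and>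
     (\<forall>i<length W. \<forall>p q. p < q \<and> q < length (W ! i) \<longrightarrow> t i p < t i q)"

text \<open>The arcs of \<open>v\<omega>\<^sub>i\<close>, each paired with its time label.\<close>

definition labeled_path ::
    "(nat \<Rightarrow> ('a,'b) pre_digraph) \<Rightarrow> nat list list \<Rightarrow> (nat \<Rightarrow> nat \<Rightarrow> nat) \<Rightarrow> 'a \<Rightarrow> nat \<Rightarrow> ('b \<times> nat) list"
  where
  "labeled_path F W t v i =
     zip (word_path F v (W ! i)) (map (t i) [0..<length (W ! i)])"

definition increasing_path ::
    "('a,'b) pre_digraph \<Rightarrow> 'a \<Rightarrow> ('b \<times> nat) list \<Rightarrow> 'a \<Rightarrow> bool" where
  "increasing_path G u P v \<longleftrightarrow>
     pre_digraph.awalk G u (map fst P) v \<and> sorted_wrt (<) (map snd P)"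

text \<open>No arc gets the same label at two different places of the family \<open>P\<close> of labeled paths.\<close>

definition conflict_free :: "'i set \<Rightarrow> ('i \<Rightarrow> ('b \<times> nat) list) \<Rightarrow> bool" where
  "conflict_free I P \<longleftrightarrow>
     (\<forall>x\<in>I. \<forall>y\<in>I. \<forall>p<length (P x). \<forall>q<length (P y).
        (x, p) \<noteq> (y, q) \<longrightarrow> P x ! p \<noteq> P y ! q)"

end

theory Submission
  imports Defs
begin

text \<open>
  Following one fixed 1-factor permutes the vertices: out-degree 1 makes each step well defined and
  in-degree 1 makes it injective. Hence, for a fixed position of a fixed word, the arc traversed
  there determines the vertex at which the path started (\<open>word_path_start_unique\<close>); the paths
  from different starting vertices, moving in parallel, never share an arc at the same position.

  Now suppose that an arc receives the same time at two places. The factors partition the arcs, so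
  both places carry the same factor symbol. A schedule never repeats a time on one factor, so
  both places are the same occurrence of that symbol, that is, the same position of the same word.
  By the previous paragraph the starting vertices agree as well, so the two places coincide
  (\<open>conflict_free_word_paths\<close>).

  In a spanning factorization the \<open>n\<close> words lead from \<open>u\<close> to \<open>n\<close> distinct vertices, hence to each
  vertex; choosing for each pair \<open>(u, v)\<close> a word from \<open>u\<close> to \<open>v\<close> selects, without repetition,
  members of the family already known to be free of conflicts.
\<close>

section \<open>Steps along a 1-factor\<close>

lemma one_factorD:
  assumes "one_factor H G"
  shows "verts H = verts G" "arcs H \<subseteq> arcs G" "tail H = tail G" "head H = head G"
    "wf_digraph H" "wf_digraph G"
  using assms by (auto simp: one_factor_def spanning_def subgraph_def compatible_def)

lemma factor_arc_out_arcs: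
  assumes "one_factor H G" and "v \<in> verts G"
  shows "factor_arc H v \<in> out_arcs H v"
proof -
  have "card (out_arcs H v) = 1"
    using assms by (auto simp: one_factor_def out_degree_def one_factorD(1)[OF assms(1)])
  then obtain e where "out_arcs H v = {e}"
    by (auto simp: card_1_singleton_iff)
  then show ?thesis
    by (simp add: factor_arc_def)
qed

lemma factor_arc_simps:
  assumes "one_factor H G" and "v \<in> verts G"
  shows "factor_arc H v \<in> arcs H" "factor_arc H v \<in> arcs G"
    "tail G (factor_arc H v) = v" "head G (factor_arc H v) \<in> verts G"
proof -
  show *: "factor_arc H v \<in> arcs H" "tail G (factor_arc H v) = v"
    using factor_arc_out_arcs[OF assms] one_factorD[OF assms(1)] by (auto simp: out_arcs_def)
  then show "factor_arc H v \<in> arcs G"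
    using one_factorD[OF assms(1)] by auto
  then show "head G (factor_arc H v) \<in> verts G"
    using one_factorD(6)[OF assms(1)] by (rule wf_digraph.head_in_verts[rotated])
qed

lemma inj_on_factor_arc:
  assumes "one_factor H G"
  shows "inj_on (factor_arc H) (verts G)"
  by (rule inj_on_inverseI[where g = "tail G"]) (rule factor_arc_simps(3)[OF assms])

text \<open>Two arcs of a 1-factor with a common head coincide by in-degree 1, and the tail of an arc
  is the vertex at which the step began.\<close>

lemma inj_on_factor_step:
  assumes "one_factor H G"
  shows "inj_on (\<lambda>v. head G (factor_arc H v)) (verts G)"
proof (rule inj_onI)
  fix u v
  assume uv: "u \<in> verts G" "v \<in> verts G"
    and eq: "head G (factor_arc H u) = head G (factor_arc H v)" (is "_ = ?x")
  have "?x \<in> verts G"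
    using factor_arc_simps(4)[OF assms uv(2)] .
  then have "card (in_arcs H ?x) = 1"
    using assms by (auto simp: one_factor_def in_degree_def one_factorD(1)[OF assms])
  then obtain e where e: "in_arcs H ?x = {e}"
    by (auto simp: card_1_singleton_iff)
  have "factor_arc H u \<in> in_arcs H ?x" "factor_arc H v \<in> in_arcs H ?x"
    using factor_arc_simps(1)[OF assms uv(1)] factor_arc_simps(1)[OF assms uv(2)] eq
    by (simp_all add: in_arcs_def one_factorD(4)[OF assms])
  then have "factor_arc H u = factor_arc H v"
    by (simp add: e)
  then show "u = v"
    using inj_on_factor_arc[OF assms] uv by (simp add: inj_on_eq_iff)
qed

section \<open>Paths described by words\<close>

lemma length_word_path [simp]: "length (word_path F v w) = length w"
  by (induction w arbitrary: v) auto

lemma awalk_word_path: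
  assumes "wf_digraph G" and "\<forall>k\<in>set w. one_factor (F k) G" and "v \<in> verts G"
  shows "pre_digraph.awalk G v (word_path F v w) (word_end G F v w)"
proof -
  interpret wf_digraph G by (rule assms(1))
  have "\<exists>x. awalk v (word_path F v w) x"
    using assms(2,3)
  proof (induction w arbitrary: v)
    case Nil
    then show ?case by (auto simp: awalk_Nil_iff)
  next
    case (Cons k w)
    then have k: "one_factor (F k) G" by simp
    show ?case
      using Cons.IH[OF _ factor_arc_simps(4)[OF k Cons.prems(2)]] Cons.prems(1)
      by (simp add: awalk_Cons_iff one_factorD(4)[OF k] factor_arc_simps[OF k Cons.prems(2)])
  qed
  then obtain x where x: "awalk v (word_path F v w) x" ..
  then have "awlast v (word_path F v w) = x"
    by (rule awalkE)
  with x show ?thesis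
    by (simp add: word_end_def)
qed

lemma word_path_nth_in_factor:
  assumes "\<forall>k\<in>set w. one_factor (F k) G" and "v \<in> verts G" and "p < length w"
  shows "word_path F v w ! p \<in> arcs (F (w ! p))"
  using assms
proof (induction w arbitrary: v p)
  case (Cons k w)
  then have k: "one_factor (F k) G" by simp
  show ?case
  proof (cases p)
    case 0
    then show ?thesis using factor_arc_simps(1)[OF k Cons.prems(2)] by simp
  next
    case (Suc q)
    then show ?thesis
      using Cons.IH[OF _ factor_arc_simps(4)[OF k Cons.prems(2)]] Cons.prems
      by (simp add: one_factorD(4)[OF k])
  qed
qed simp

text \<open>The first \<open>p\<close> steps and the choice of the next arc are injective in the starting
  vertex, hence so is their composition.\<close>

lemma word_path_start_unique:
  assumes "\<forall>k\<in>set w. one_factor (F k) G" and "p < length w"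
  shows "inj_on (\<lambda>v. word_path F v w ! p) (verts G)"
  using assms
proof (induction w arbitrary: p)
  case (Cons k w)
  then have k: "one_factor (F k) G" by simp
  show ?case
  proof (cases p)
    case 0
    then show ?thesis using inj_on_factor_arc[OF k] by simp
  next
    case (Suc q)
    let ?step = "\<lambda>v. head G (factor_arc (F k) v)"
    have "inj_on (\<lambda>v. word_path F v w ! q) (verts G)"
      using Cons Suc by simp
    then have "inj_on (\<lambda>v. word_path F v w ! q) (?step ` verts G)"
      by (rule inj_on_subset) (use factor_arc_simps(4)[OF k] in auto)
    from comp_inj_on[OF inj_on_factor_step[OF k] this] show ?thesis
      by (simp add: Suc o_def one_factorD(4)[OF k])
  qed
qed simp

section \<open>Scheduled labels\<close>

lemma one_factoring_word_list_nth:
  assumes "one_factoring G d F" and "word_list d W" and "i < length W"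
  shows "\<forall>k\<in>set (W ! i). one_factor (F k) G"
proof -
  have "set (W ! i) \<subseteq> {1..d}"
    using assms(2) nth_mem[OF assms(3)] by (auto simp: word_list_def)
  then show ?thesis
    using assms(1) unfolding one_factoring_def by blast
qed

lemma length_labeled_path [simp]: "length (labeled_path F W t v i) = length (W ! i)"
  by (simp add: labeled_path_def)

lemma labeled_path_nth:
  "p < length (W ! i) \<Longrightarrow> labeled_path F W t v i ! p = (word_path F v (W ! i) ! p, t i p)"
  by (simp add: labeled_path_def)

lemma increasing_labeled_path:
  assumes "wf_digraph G" and "one_factoring G d F" and "word_list d W" and "schedule W t"
    and "v \<in> verts G" and "i < length W"
  shows "increasing_path G v (labeled_path F W t v i) (word_end G F v (W ! i))"
proof -
  have "map fst (labeled_path F W t v i) = word_path F v (W ! i)"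
    and "map snd (labeled_path F W t v i) = map (t i) [0..<length (W ! i)]"
    by (simp_all add: labeled_path_def)
  moreover have "sorted_wrt (<) (map (t i) [0..<length (W ! i)])"
    using assms(4,6) by (simp add: sorted_wrt_iff_nth_less schedule_def)
  ultimately show ?thesis
    using awalk_word_path[OF assms(1) one_factoring_word_list_nth[OF assms(2,3,6)] assms(5)]
    by (simp add: increasing_path_def)
qed

lemma one_factoring_arc_unique:
  assumes "one_factoring G d F" and "k \<in> {1..d}" and "l \<in> {1..d}"
    and "e \<in> arcs (F k)" and "e \<in> arcs (F l)"
  shows "k = l"
  using assms unfolding one_factoring_def disjoint_family_on_def by blast

lemma schedule_time_unique:
  assumes "schedule W t" and "i < length W" and "p < length (W ! i)"
    and "j < length W" and "q < length (W ! j)"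
    and "W ! i ! p = W ! j ! q" and "t i p = t j q"
  shows "i = j \<and> p = q"
proof (rule ccontr)
  have "(i, p) \<in> occurrences W" "(j, q) \<in> occurrences W"
    using assms(2-5) by (simp_all add: occurrences_def)
  moreover assume "\<not> (i = j \<and> p = q)"
  ultimately have "t i p \<noteq> t j q"
    using assms(1,6) unfolding schedule_def by fast
  then show False
    using assms(7) by simp
qed

lemma conflict_free_word_paths:
  assumes "one_factoring G d F" and "word_list d W" and "schedule W t"
  shows "conflict_free (verts G \<times> {i. i < length W}) (\<lambda>(v, i). labeled_path F W t v i)"
proof -
  have "u = v \<and> i = j \<and> p = q"
    if uv: "u \<in> verts G" "v \<in> verts G" and ij: "i < length W" "j < length W"
      and p: "p < length (W ! i)" and q: "q < length (W ! j)"
      and eq: "labeled_path F W t u i ! p = labeled_path F W t v j ! q" for u v i j p q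
  proof -
    note factors = one_factoring_word_list_nth[OF assms(1,2)]
    have arc: "word_path F u (W ! i) ! p = word_path F v (W ! j) ! q" and time: "t i p = t j q"
      using eq by (simp_all add: labeled_path_nth p q)
    have "set (W ! i) \<subseteq> {1..d}" "set (W ! j) \<subseteq> {1..d}"
      using assms(2) ij by (force simp: word_list_def dest: nth_mem)+
    then have "W ! i ! p \<in> {1..d}" "W ! j ! q \<in> {1..d}"
      using nth_mem p q by blast+
    then have "W ! i ! p = W ! j ! q"
      using one_factoring_arc_unique[OF assms(1)] arc
        word_path_nth_in_factor[where v = u, OF factors[OF ij(1)] uv(1) p]
        word_path_nth_in_factor[where v = v, OF factors[OF ij(2)] uv(2) q]
      by metis
    from schedule_time_unique[OF assms(3) ij(1) p ij(2) q this time]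
    have "i = j" "p = q" by auto
    moreover from this have "u = v"
      using inj_onD[OF word_path_start_unique[OF factors[OF ij(1)] p]] arc uv by simp
    ultimately show ?thesis by simp
  qed
  then show ?thesis
    unfolding conflict_free_def by fastforce
qed

text \<open>Passing to a subfamily, possibly with new indices, creates no conflict as long as no
  member is taken twice.\<close>

lemma conflict_free_reindex:
  assumes "conflict_free I P" and "inj_on f J" and "f ` J \<subseteq> I" and "\<And>x. x \<in> J \<Longrightarrow> Q x = P (f x)"
  shows "conflict_free J Q"
  unfolding conflict_free_def
proof (intro ballI allI impI)
  fix x y p q
  assume xy: "x \<in> J" "y \<in> J" and pq: "p < length (Q x)" "q < length (Q y)" "(x, p) \<noteq> (y, q)"
  have "(f x, p) \<noteq> (f y, q)"
    using pq(3) inj_onD[OF assms(2) _ xy] by auto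
  moreover have "f x \<in> I" "f y \<in> I"
    using xy assms(3) by auto
  ultimately show "Q x ! p \<noteq> Q y ! q"
    using assms(1) pq(1,2) unfolding conflict_free_def assms(4)[OF xy(1)] assms(4)[OF xy(2)] by blast
qed

section \<open>Reaching every vertex\<close>

text \<open>Injectivity of \<open>i \<mapsto> u\<omega>\<^sub>i\<close> forces surjectivity, as there are as many words as vertices.
  Finiteness matters: on an infinite vertex set \<open>card\<close> would be 0.\<close>

lemma spanning_factorization_reaches:
  assumes "fin_digraph G" and "spanning_factorization G d F W" and "u \<in> verts G" and "v \<in> verts G"
  shows "\<exists>i<length W. word_end G F u (W ! i) = v"
proof -
  interpret fin_digraph G by (rule assms(1))
  let ?end = "\<lambda>i. word_end G F u (W ! i)"
  have F: "one_factoring G d F" "word_list d W" "length W = card (verts G)"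
    and inj: "inj_on ?end {..<length W}"
    using assms(2,3) by (auto simp: spanning_factorization_def)
  have "?end ` {..<length W} \<subseteq> verts G"
    using awalk_last_in_verts[OF awalk_word_path[OF wf_digraph one_factoring_word_list_nth[OF F(1,2)]
          assms(3)]] by auto
  moreover have "card (?end ` {..<length W}) = card (verts G)"
    using card_image[OF inj] F(3) by simp
  ultimately have "?end ` {..<length W} = verts G"
    by (intro card_subset_eq) auto
  then have "v \<in> ?end ` {..<length W}"
    using assms(4) by simp
  then show ?thesis
    by blast
qed

theorem theorem1:
  fixes G :: "('a,'b) pre_digraph" and d :: nat
    and F :: "nat \<Rightarrow> ('a,'b) pre_digraph"
    and W :: "nat list list" and t :: "nat \<Rightarrow> nat \<Rightarrow> nat"
  assumes "regular_digraph G d"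
    and "one_factoring G d F"
    and "word_list d W"
    and "schedule W t"
  shows "(\<forall>v\<in>verts G. \<forall>i<length W. W ! i \<noteq> [] \<longrightarrow>
            length (labeled_path F W t v i) = length (W ! i) \<and>
            increasing_path G v (labeled_path F W t v i) (word_end G F v (W ! i)))
       \<and> conflict_free (verts G \<times> {i. i < length W \<and> W ! i \<noteq> []})
            (\<lambda>(v, i). labeled_path F W t v i)
       \<and> (spanning_factorization G d F W \<longrightarrow>
            (\<exists>c :: 'a \<Rightarrow> 'a \<Rightarrow> nat.
               (\<forall>u\<in>verts G. \<forall>v\<in>verts G. u \<noteq> v \<longrightarrow>
                  c u v < length W \<and> W ! c u v \<noteq> [] \<and>
                  increasing_path G u (labeled_path F W t u (c u v)) v) \<and>
               conflict_free {(u, v). u \<in> verts G \<and> v \<in> verts G \<and> u \<noteq> v}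
                 (\<lambda>(u, v). labeled_path F W t u (c u v))))"
proof (intro conjI impI)
  have fin: "fin_digraph G"
    using assms(1) by (simp add: regular_digraph_def)
  then have wf: "wf_digraph G"
    by (rule fin_digraph.axioms)
  note incr = increasing_labeled_path[OF wf assms(2,3,4)]
  note free = conflict_free_word_paths[OF assms(2,3,4)]
  show "\<forall>v\<in>verts G. \<forall>i<length W. W ! i \<noteq> [] \<longrightarrow>
      length (labeled_path F W t v i) = length (W ! i) \<and>
      increasing_path G v (labeled_path F W t v i) (word_end G F v (W ! i))"
    using incr by simp
  show "conflict_free (verts G \<times> {i. i < length W \<and> W ! i \<noteq> []})
      (\<lambda>(v, i). labeled_path F W t v i)"
    by (rule conflict_free_reindex[OF free, where f = id]) auto
  assume span: "spanning_factorization G d F W"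
  define c where "c u v = (SOME i. i < length W \<and> word_end G F u (W ! i) = v)" for u v
  have c: "c u v < length W" "word_end G F u (W ! c u v) = v"
    if "u \<in> verts G" "v \<in> verts G" for u v
    using someI_ex[OF spanning_factorization_reaches[OF fin span that]] by (simp_all add: c_def)
  have "W ! c u v \<noteq> []" if "u \<in> verts G" "v \<in> verts G" "u \<noteq> v" for u v
    \<comment> \<open>The empty word ends where it starts.\<close>
    using c(2)[OF that(1,2)] that(3) by (auto simp: word_end_def pre_digraph.awalk_verts.simps)
  moreover have "increasing_path G u (labeled_path F W t u (c u v)) v"
    if "u \<in> verts G" "v \<in> verts G" for u v
    using incr[OF that(1) c(1)[OF that]] c(2)[OF that] by simp
  moreover have "conflict_free {(u, v). u \<in> verts G \<and> v \<in> verts G \<and> u \<noteq> v}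
      (\<lambda>(u, v). labeled_path F W t u (c u v))"
  proof (rule conflict_free_reindex[OF free, where f = "\<lambda>(u, v). (u, c u v)"])
    \<comment> \<open>The word from \<open>u\<close> to \<open>v\<close> determines \<open>v\<close> as the end of its path from \<open>u\<close>.\<close>
    show "inj_on (\<lambda>(u, v). (u, c u v)) {(u, v). u \<in> verts G \<and> v \<in> verts G \<and> u \<noteq> v}"
      by (rule inj_onI) (auto, metis c(2))
  qed (use c(1) in auto)
  ultimately show "\<exists>c :: 'a \<Rightarrow> 'a \<Rightarrow> nat.
      (\<forall>u\<in>verts G. \<forall>v\<in>verts G. u \<noteq> v \<longrightarrow>
         c u v < length W \<and> W ! c u v \<noteq> [] \<and>
         increasing_path G u (labeled_path F W t u (c u v)) v) \<and>
      conflict_free {(u, v). u \<in> verts G \<and> v \<in> verts G \<and> u \<noteq> v}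
        (\<lambda>(u, v). labeled_path F W t u (c u v))"
    using c(1) by (intro exI[of _ c]) simp
qed

end
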